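(* Let $q\in(0,1)$ and let $a\in\mathbb{R}$ with $0<|a|<1$. Then for all $m,n\in\mathbb{N}_{0}$, the continuous big $q$-Hermite polynomials $H_n(\,\cdot\,;a\,|\,q)$ satisfy \[ \frac{(q;q)_{\infty}}{2\pi}\int_{0}^{\pi}H_{m}(\cos\theta;a\,|\,q)\,H_{n}(\cos\theta;a\,|\,q)\left|(e^{2\mathrm{i}\theta},qe^{\mathrm{i}\theta}/a;q)_{\infty}\right|^{2}\mathrm{d}\theta =(-a)^{m+n}q^{\frac{m(m-1)+n(n-1)}{2}}\;{}_{0}\phi_{1}\!\left(-;\,0;\,q,\,\frac{q^{2-m-n}}{a^{2}}\right). \]
   Context: For $q\in(0,1)$: $(c;q)_{n}:=\prod_{j=0}^{n-1}(1-cq^{j})$ for $n\in\mathbb{N}_0\cup\{\infty\}$ and $(c_{1},\dots,c_{p};q)_{n}:=(c_{1};q)_{n}\cdots(c_{p};q)_{n}$. The basic hypergeometric series used is \[ {}_{0}\phi_{1}(-;c;q,z)=\sum_{k=0}^{\infty}\frac{q^{k(k-1)}z^{k}}{(c;q)_{k}(q;q)_{k}} \] (here with $c=0$, so $(c;q)_k=1$). The continuous big $q$-Hermite polynomials are the Al-Salam--Chihara polynomials with $b=0$, $H_{n}(x;a\,|\,q)=Q_{n}(x;a,0\,|\,q)$; that is, $H_{-1}(x;a\,|\,q)=0$, $H_{0}(x;a\,|\,q)=1$ and, for $n\in\mathbb{N}_0$, \[ H_{n+1}(x;a\,|\,q)=(2x-aq^{n})H_{n}(x;a\,|\,q)-(1-q^{n})H_{n-1}(x;a\,|\,q).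 \] $\mathbb{N}_0=\{0,1,2,\dots\}$. *)

theory Defs
  imports "HOL-Analysis.Analysis"
begin

definition qpoch :: "'a::real_normed_field \<Rightarrow> 'a \<Rightarrow> nat \<Rightarrow> 'a" where
  "qpoch c q n = (\<Prod>j<n. 1 - c * q ^ j)"

text \<open>\<open>prodinf\<close> takes the value \<open>0\<close> when finitely many factors vanish and the
  product of the remaining ones converges, so it is the usual \<open>(c;q)\<close> with index infinity
  for every \<open>c\<close> whenever \<open>q\<close> has norm less than \<open>1\<close>.\<close>

definition qpoch_inf :: "'a::real_normed_field \<Rightarrow> 'a \<Rightarrow> 'a" where
  "qpoch_inf c q = prodinf (\<lambda>j. 1 - c * q ^ j)"

definition qphi01 :: "real \<Rightarrow> real \<Rightarrow> real \<Rightarrow> real" where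
  "qphi01 c q z = (\<Sum>k. q ^ (k * (k - 1)) * z ^ k / (qpoch c q k * qpoch q q k))"

text \<open>Continuous big \<open>q\<close>-Hermite polynomials. In the three-term recurrence
  the coefficient of the term of index \<open>-1\<close> is \<open>1 - q ^ 0 = 0\<close>, so its first step gives
  \<open>2 * x - a\<close>; the last equation is the recurrence with \<open>n + 1\<close> in place of \<open>n\<close>.\<close>

fun big_qHermite :: "real \<Rightarrow> real \<Rightarrow> nat \<Rightarrow> real \<Rightarrow> real" where
  "big_qHermite a q 0 x = 1"
| "big_qHermite a q (Suc 0) x = 2 * x - a"
| "big_qHermite a q (Suc (Suc n)) x =
     (2 * x - a * q ^ Suc n) * big_qHermite a q (Suc n) x
     - (1 - q ^ Suc n) * big_qHermite a q n x"

end

theory Submission imports Defs begin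

text \<open>Put \<open>t = q / a\<close> and write \<open>\<Phi>\<close> for the series on the right, which satisfies
  \<open>\<Phi> y = \<Phi> (q * y) + y * \<Phi> (q\<^sup>2 * y)\<close>. Multiplying a product of two big \<open>q\<close>-Hermite polynomials
  by \<open>2 * x\<close>, with the recurrence applied to either factor, shows that the integrals
  \<open>I m n\<close> satisfy a recurrence that determines them from \<open>I m 0\<close>; the right-hand side satisfies the
  same recurrence. The column \<open>I m 0\<close> comes in the same way from the mixed integrals of a
  big \<open>q\<close>-Hermite and an ordinary \<open>q\<close>-Hermite polynomial (\<open>a = 0\<close>), which again have a closed
  form thanks to \<open>a * t = q\<close>. This leaves the integrals \<open>J n t\<close> of a single \<open>q\<close>-Hermite polynomial.
  Splitting off the factor \<open>1 - 2 * t * x + t\<^sup>2\<close> of the weight relates \<open>J n t\<close> to the values at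
  \<open>t * q\<close>, and iterating reduces the claim to \<open>t = 0\<close>, that is to the orthogonality relation
  for the \<open>q\<close>-Hermite weight, which is read off its explicit Fourier coefficients.\<close>

section \<open>Weighted integrals\<close>

text \<open>Integrability against every continuous factor, rather than continuity of
  \<open>w\<close>, survives bounded pointwise limits, and the weights with infinite products arise
  as such limits.\<close>

definition cos_weight :: "(real \<Rightarrow> real) \<Rightarrow> bool" where
  "cos_weight w \<longleftrightarrow> (\<forall>\<theta>\<in>{0..pi}. 0 \<le> w \<theta>) \<and>
     (\<forall>u. continuous_on {0..pi} u \<longrightarrow> (\<lambda>\<theta>. u \<theta> * w \<theta>) integrable_on {0..pi})"

lemma cos_weight_one: "cos_weight (\<lambda>_. 1)"
  by (auto simp: cos_weight_def intro: integrable_continuous_interval)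

text \<open>Dominated convergence with majorant
  \<open>\<bar>v \<theta>\<bar> * C * w \<theta>\<close>. It is applied twice: from the constant
  weight to \<open>herm_weight\<close>, and from there to \<open>shift_weight\<close>.\<close>

lemma cos_weight_limit:
  fixes w f :: "real \<Rightarrow> real" and g :: "nat \<Rightarrow> real \<Rightarrow> real"
  assumes w: "cos_weight w"
    and cont: "\<And>N. continuous_on {0..pi} (g N)"
    and bnd: "\<And>N \<theta>. \<theta> \<in> {0..pi} \<Longrightarrow> 0 \<le> g N \<theta> \<and> g N \<theta> \<le> C"
    and lim: "\<And>\<theta>. \<theta> \<in> {0..pi} \<Longrightarrow> (\<lambda>N. g N \<theta>) \<longlonglongrightarrow> f \<theta>"
  shows "cos_weight (\<lambda>\<theta>. f \<theta> * w \<theta>)"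
    and "continuous_on {0..pi} u \<Longrightarrow>
      (\<lambda>N. integral {0..pi} (\<lambda>\<theta>. u \<theta> * g N \<theta> * w \<theta>))
        \<longlonglongrightarrow> integral {0..pi} (\<lambda>\<theta>. u \<theta> * (f \<theta> * w \<theta>))"
proof -
  have w0: "0 \<le> w \<theta>" if "\<theta> \<in> {0..pi}" for \<theta>
    using w that by (auto simp: cos_weight_def)
  have int: "(\<lambda>\<theta>. v \<theta> * w \<theta>) integrable_on {0..pi}" if "continuous_on {0..pi} v" for v
    using w that by (auto simp: cos_weight_def)
  have main: "(\<lambda>\<theta>. v \<theta> * (f \<theta> * w \<theta>)) integrable_on {0..pi} \<and>
     (\<lambda>N. integral {0..pi} (\<lambda>\<theta>. v \<theta> * g N \<theta> * w \<theta>))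
        \<longlonglongrightarrow> integral {0..pi} (\<lambda>\<theta>. v \<theta> * (f \<theta> * w \<theta>))"
    if v: "continuous_on {0..pi} v" for v
  proof -
    have 1: "(\<lambda>\<theta>. v \<theta> * g N \<theta> * w \<theta>) integrable_on {0..pi}" for N
      by (intro int continuous_intros v cont)
    have 2: "(\<lambda>\<theta>. (\<bar>v \<theta>\<bar> * C) * w \<theta>) integrable_on {0..pi}"
      by (intro int continuous_intros v)
    have 3: "norm (v \<theta> * g N \<theta> * w \<theta>) \<le> (\<bar>v \<theta>\<bar> * C) * w \<theta>" if "\<theta> \<in> {0..pi}" for N \<theta>
      using bnd[OF that, of N] w0[OF that]
      by (auto simp: abs_mult intro!: mult_mono)
    have 4: "(\<lambda>N. v \<theta> * g N \<theta> * w \<theta>) \<longlonglongrightarrow> v \<theta> * (f \<theta> * w \<theta>)" if "\<theta> \<in> {0..pi}" for \<theta>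
      using lim[OF that] by (auto intro!: tendsto_eq_intros)
    show ?thesis
      using dominated_convergence[OF 1 2 3 4] by blast
  qed
  have "0 \<le> f \<theta>" if "\<theta> \<in> {0..pi}" for \<theta>
    by (rule LIMSEQ_le_const[OF lim[OF that]]) (use bnd[OF that] in auto)
  then show "cos_weight (\<lambda>\<theta>. f \<theta> * w \<theta>)"
    using main w0 by (auto simp: cos_weight_def)
  show "continuous_on {0..pi} u \<Longrightarrow>
      (\<lambda>N. integral {0..pi} (\<lambda>\<theta>. u \<theta> * g N \<theta> * w \<theta>))
        \<longlonglongrightarrow> integral {0..pi} (\<lambda>\<theta>. u \<theta> * (f \<theta> * w \<theta>))"
    using main by blast
qed

lemma integral_weight_lincomb:
  assumes w: "cos_weight w"
    and cont: "continuous_on {0..pi} u" "continuous_on {0..pi} v" "continuous_on {0..pi} r"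
    and eq: "\<And>\<theta>. f \<theta> = \<alpha> * u \<theta> + \<beta> * v \<theta> + \<gamma> * r \<theta>"
  shows "integral {0..pi} (\<lambda>\<theta>. f \<theta> * w \<theta>) =
    \<alpha> * integral {0..pi} (\<lambda>\<theta>. u \<theta> * w \<theta>) + \<beta> * integral {0..pi} (\<lambda>\<theta>. v \<theta> * w \<theta>)
      + \<gamma> * integral {0..pi} (\<lambda>\<theta>. r \<theta> * w \<theta>)"
proof -
  have int: "(\<lambda>\<theta>. v \<theta> * w \<theta>) integrable_on {0..pi}" if "continuous_on {0..pi} v" for v
    using w that by (auto simp: cos_weight_def)
  have "((\<lambda>\<theta>. \<alpha> * (u \<theta> * w \<theta>) + \<beta> * (v \<theta> * w \<theta>) + \<gamma> * (r \<theta> * w \<theta>)) has_integral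
    \<alpha> * integral {0..pi} (\<lambda>\<theta>. u \<theta> * w \<theta>) + \<beta> * integral {0..pi} (\<lambda>\<theta>. v \<theta> * w \<theta>)
      + \<gamma> * integral {0..pi} (\<lambda>\<theta>. r \<theta> * w \<theta>)) {0..pi}"
    by (intro has_integral_add has_integral_mult_right integrable_integral int cont)
  moreover have "(\<lambda>\<theta>. \<alpha> * (u \<theta> * w \<theta>) + \<beta> * (v \<theta> * w \<theta>) + \<gamma> * (r \<theta> * w \<theta>))
      = (\<lambda>\<theta>. f \<theta> * w \<theta>)"
    by (simp add: eq algebra_simps)
  ultimately show ?thesis by (simp add: integral_unique)
qed

section \<open>Infinite products\<close>

text \<open>The squared modulus of \<open>qpoch (t * z) q N\<close> at
  \<open>z = cis \<theta>\<close>, written as a polynomial in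
  \<open>x = cos \<theta>\<close>.\<close>

definition qprod :: "real \<Rightarrow> nat \<Rightarrow> real \<Rightarrow> real \<Rightarrow> real" where
  "qprod q N t x = (\<Prod>j<N. 1 - 2 * (t * q ^ j) * x + (t * q ^ j)\<^sup>2)"

lemma qprod_0 [simp]: "qprod q 0 t x = 1"
  by (simp add: qprod_def)

lemma qprod_Suc: "qprod q (Suc N) t x = qprod q N t x * (1 - 2 * (t * q ^ N) * x + (t * q ^ N)\<^sup>2)"
  by (simp add: qprod_def)

text \<open>Splitting off the first factor instead of the last one replaces \<open>t\<close> by
  \<open>t * q\<close>; this drives the reduction to \<open>t = 0\<close>.\<close>

lemma qprod_Suc_shift: "qprod q (Suc N) t x = (1 - 2 * t * x + t\<^sup>2) * qprod q N (t * q) x"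
  unfolding qprod_def by (subst prod.lessThan_Suc_shift) (simp add: mult.assoc)

lemma continuous_on_qprod [continuous_intros]:
  "continuous_on S f \<Longrightarrow> continuous_on S (\<lambda>\<theta>. qprod q N t (f \<theta>))"
  unfolding qprod_def by (intro continuous_intros)

lemma cmod_one_minus_cis: "(cmod (1 - complex_of_real s * cis \<theta>))\<^sup>2 = 1 - 2 * s * cos \<theta> + s\<^sup>2"
proof -
  have "(cmod (1 - complex_of_real s * cis \<theta>))\<^sup>2 = (1 - s * cos \<theta>)\<^sup>2 + (s * sin \<theta>)\<^sup>2"
    by (simp add: cmod_power2)
  also have "\<dots> = 1 - 2 * s * cos \<theta> + s\<^sup>2 * ((sin \<theta>)\<^sup>2 + (cos \<theta>)\<^sup>2)"
    by (simp only: power2_eq_square algebra_simps)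
  finally show ?thesis by simp
qed

lemma cmod_qpoch:
  "(cmod (qpoch (complex_of_real t * cis \<theta>) (complex_of_real q) N))\<^sup>2 = qprod q N t (cos \<theta>)"
proof -
  have "(cmod (qpoch (complex_of_real t * cis \<theta>) (complex_of_real q) N))\<^sup>2
      = (\<Prod>j<N. (cmod (1 - complex_of_real (t * q ^ j) * cis \<theta>))\<^sup>2)"
    by (simp add: qpoch_def prod_norm[symmetric] prod_power_distrib mult_ac)
  then show ?thesis
    by (simp only: cmod_one_minus_cis qprod_def)
qed

lemma convergent_prod_qpoch:
  fixes c q :: "'a::{real_normed_field, banach, heine_borel}"
  assumes "norm q < 1"
  shows "convergent_prod (\<lambda>j. 1 - c * q ^ j)"
proof -
  have "summable (\<lambda>j. norm ((1 - c * q ^ j) - 1))"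
    using assms by (simp add: norm_mult norm_power summable_mult summable_geometric)
  then show ?thesis
    by (intro abs_convergent_prod_imp_convergent_prod summable_imp_abs_convergent_prod)
qed

lemma qpoch_LIMSEQ:
  fixes c q :: "'a::{real_normed_field, banach, heine_borel}"
  assumes "norm q < 1"
  shows "(\<lambda>N. qpoch c q N) \<longlonglongrightarrow> qpoch_inf c q"
proof -
  from convergent_prod_qpoch[OF assms, of c] have "(\<lambda>N. \<Prod>j\<le>N. 1 - c * q ^ j) \<longlonglongrightarrow> qpoch_inf c q"
    unfolding qpoch_inf_def by (rule convergent_prod_LIMSEQ)
  then have "(\<lambda>N. qpoch c q (Suc N)) \<longlonglongrightarrow> qpoch_inf c q"
    by (simp add: qpoch_def lessThan_Suc_atMost)
  then show ?thesis by (rule LIMSEQ_imp_Suc)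
qed

lemma qprod_LIMSEQ:
  assumes "\<bar>q\<bar> < 1"
  shows "(\<lambda>N. qprod q N t (cos \<theta>)) \<longlonglongrightarrow>
    (cmod (qpoch_inf (complex_of_real t * cis \<theta>) (complex_of_real q)))\<^sup>2"
  using tendsto_power[OF tendsto_norm[OF qpoch_LIMSEQ], of "complex_of_real q" "complex_of_real t * cis \<theta>" 2]
  using assms by (simp add: cmod_qpoch)

lemma qprod_nonneg: 
  assumes "\<bar>x\<bar> \<le> 1" shows "0 \<le> qprod q N t x"
proof -
  have "qprod q N t x = qprod q N t (cos (arccos x))" using assms by simp
  then show ?thesis by (metis cmod_qpoch zero_le_power2)
qed

text \<open>With \<open>s = t * q ^ j\<close> each factor is at most
  \<open>(1 + \<bar>s\<bar>) ^ 2 \<le> exp (2 * \<bar>s\<bar>)\<close>, and the exponents form a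
  geometric series. The bound is independent of \<open>N\<close>, as needed for domination and for
  the error estimate.\<close>

lemma qprod_le:
  assumes x: "\<bar>x\<bar> \<le> 1" and q: "0 < q" "q < 1"
  shows "qprod q N t x \<le> exp (2 * \<bar>t\<bar> / (1 - q))"
proof -
  have "qprod q N t x \<le> (\<Prod>j<N. exp (2 * (\<bar>t\<bar> * q ^ j)))"
    unfolding qprod_def
  proof (rule prod_mono, safe)
    fix j
    define s where "s = t * q ^ j"
    have abs_s: "\<bar>s\<bar> = \<bar>t\<bar> * q ^ j" using q by (simp add: s_def abs_mult)
    have sx: "\<bar>s * x\<bar> \<le> \<bar>s\<bar>" using x by (simp add: abs_mult mult_left_le)
    have "0 \<le> (1 - \<bar>s\<bar>)\<^sup>2" by simp
    then show "0 \<le> 1 - 2 * (t * q ^ j) * x + (t * q ^ j)\<^sup>2"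
      using sx unfolding s_def[symmetric] by (simp add: power2_eq_square algebra_simps abs_le_iff)
    have "1 - 2 * s * x + s\<^sup>2 \<le> (1 + \<bar>s\<bar>)\<^sup>2"
      using sx by (simp add: power2_eq_square algebra_simps abs_le_iff)
    also have "\<dots> \<le> (exp \<bar>s\<bar>)\<^sup>2" by (intro power_mono) auto
    also have "\<dots> = exp (2 * (\<bar>t\<bar> * q ^ j))" by (simp add: abs_s flip: exp_of_nat_mult)
    finally show "1 - 2 * (t * q ^ j) * x + (t * q ^ j)\<^sup>2 \<le> exp (2 * (\<bar>t\<bar> * q ^ j))"
      by (simp add: s_def)
  qed
  also have "\<dots> = exp (2 * \<bar>t\<bar> * (\<Sum>j<N. q ^ j))"
    by (simp add: exp_sum[symmetric] sum_distrib_left mult.assoc)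
  also have "(\<Sum>j<N. q ^ j) \<le> 1 / (1 - q)"
    using q by (simp add: sum_gp_strict divide_right_mono)
  then have "exp (2 * \<bar>t\<bar> * (\<Sum>j<N. q ^ j)) \<le> exp (2 * \<bar>t\<bar> * (1 / (1 - q)))"
    by (intro exp_le_cancel_iff[THEN iffD2] mult_left_mono) auto
  finally show ?thesis by simp
qed

section \<open>Trigonometric moments\<close>

definition tri :: "int \<Rightarrow> int" where
  "tri k = k * (k - 1) div 2"

text \<open>The numerator grows by \<open>k * 2\<close>, a multiple of the divisor, so
  \<open>div\<close> splits for all integers \<open>k\<close>.\<close>

lemma tri_add1: "tri (k + 1) = tri k + k"
proof -
  have "(k + 1) * ((k + 1) - 1) = k * (k - 1) + k * 2" by (simp add: algebra_simps)
  then show ?thesis unfolding tri_def by simp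
qed

lemma tri_0 [simp]: "tri 0 = 0" and tri_1 [simp]: "tri 1 = 0"
  by (simp_all add: tri_def)

lemma tri_minus: "tri (- k) = tri (k + 1)"
  by (simp add: tri_def algebra_simps)

lemma tri_int: "tri (int n) = int (n * (n - 1) div 2)"
  by (cases n) (simp_all add: tri_def zdiv_int algebra_simps)

section \<open>The recurrence under the integral\<close>

text \<open>At \<open>n = 0\<close> the truncated index \<open>n - 1\<close> is \<open>0\<close>,
  but its coefficient \<open>1 - q ^ 0\<close> vanishes.\<close>

lemma big_qHermite_Suc:
  "big_qHermite a q (Suc n) x =
     (2 * x - a * q ^ n) * big_qHermite a q n x - (1 - q ^ n) * big_qHermite a q (n - 1) x"
  by (cases n) auto

lemma continuous_on_big_qHermite [continuous_intros]:
  "continuous_on S f \<Longrightarrow> continuous_on S (\<lambda>\<theta>. big_qHermite a q n (f \<theta>))"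
proof (induction n rule: less_induct)
  case (less n)
  show ?case
  proof (cases n)
    case (Suc k)
    then have "continuous_on S (\<lambda>\<theta>. (2 * f \<theta> - a * q ^ k) * big_qHermite a q k (f \<theta>)
        - (1 - q ^ k) * big_qHermite a q (k - 1) (f \<theta>))"
      by (intro continuous_intros less.IH less.prems) auto
    then show ?thesis by (simp only: Suc big_qHermite_Suc)
  qed simp
qed

lemma integral_mult_big_qHermite:
  assumes "cos_weight w" and [continuous_intros]: "continuous_on {0..pi} u"
  shows "integral {0..pi} (\<lambda>\<theta>. (2 * cos \<theta> * big_qHermite a q n (cos \<theta>) * u \<theta>) * w \<theta>) =
    integral {0..pi} (\<lambda>\<theta>. (big_qHermite a q (Suc n) (cos \<theta>) * u \<theta>) * w \<theta>)
    + a * q ^ n * integral {0..pi} (\<lambda>\<theta>. (big_qHermite a q n (cos \<theta>) * u \<theta>) * w \<theta>)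
    + (1 - q ^ n) * integral {0..pi} (\<lambda>\<theta>. (big_qHermite a q (n - 1) (cos \<theta>) * u \<theta>) * w \<theta>)"
  by (subst integral_weight_lincomb[OF assms(1), where \<alpha> = 1 and \<beta> = "a * q ^ n" and \<gamma> = "1 - q ^ n"
        and u = "\<lambda>\<theta>. big_qHermite a q (Suc n) (cos \<theta>) * u \<theta>"
        and v = "\<lambda>\<theta>. big_qHermite a q n (cos \<theta>) * u \<theta>"
        and r = "\<lambda>\<theta>. big_qHermite a q (n - 1) (cos \<theta>) * u \<theta>"])
    (auto intro!: continuous_intros simp: big_qHermite_Suc algebra_simps simp del: big_qHermite.simps)

text \<open>The factor \<open>2 * cos \<theta>\<close> is absorbed by either polynomial. The case
  \<open>b = 0\<close> serves the mixed integrals, the case \<open>b = a\<close> the final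
  ones.\<close>

lemma integral_big_qHermite_pair_rec:
  fixes a b q :: real and w :: "real \<Rightarrow> real"
  assumes w: "cos_weight w"
  defines "M \<equiv> \<lambda>n m. integral {0..pi}
    (\<lambda>\<theta>. (big_qHermite a q n (cos \<theta>) * big_qHermite b q m (cos \<theta>)) * w \<theta>)"
  shows "M (Suc n) m + a * q ^ n * M n m + (1 - q ^ n) * M (n - 1) m
    = M n (Suc m) + b * q ^ m * M n m + (1 - q ^ m) * M n (m - 1)"
proof -
  have c: "continuous_on {0..pi} (\<lambda>\<theta>. big_qHermite c q n (cos \<theta>))" for c n
    by (intro continuous_intros)
  show ?thesis
    using integral_mult_big_qHermite[OF w c, of a q n b m]
      integral_mult_big_qHermite[OF w c, of b q m a n]
    by (simp add: M_def mult_ac del: big_qHermite.simps)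
qed

section \<open>Orthogonality of the continuous \<open>q\<close>-Hermite polynomials\<close>

locale q_base =
  fixes q :: real
  assumes q_pos: "0 < q" and q_less_1: "q < 1"
begin

lemma q_nz [simp]: "q \<noteq> 0"
  using q_pos by simp

lemma abs_q: "\<bar>q\<bar> < 1"
  using q_pos q_less_1 by simp

lemma qpoch_Suc: "qpoch q q (Suc n) = qpoch q q n * (1 - q ^ Suc n)"
  by (simp add: qpoch_def)

lemma qpoch_0: "qpoch c q 0 = 1"
  by (simp add: qpoch_def)

lemma qpoch_pos: "0 < qpoch q q n"
  unfolding qpoch_def
  by (intro prod_pos) (use q_pos q_less_1 power_Suc_less_one[of q] in auto)

lemma qpoch_inf_nz: "qpoch_inf q q \<noteq> 0"
proof -
  have "convergent_prod (\<lambda>j. 1 - q * q ^ j)"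
    using abs_q by (intro convergent_prod_qpoch) simp
  moreover have "1 - q * q ^ j \<noteq> 0" for j
    using power_Suc_less_one[OF q_pos q_less_1, of j] by simp
  ultimately show ?thesis
    unfolding qpoch_inf_def by (intro prodinf_nonzero)
qed

section \<open>Powers of \<open>q\<close> and reciprocal \<open>q\<close>-factorials with integer
  index\<close>

definition tri_pow :: "int \<Rightarrow> real" where
  "tri_pow k = q powi tri k"

lemma tri_pow_add1: "tri_pow (k + 1) = tri_pow k * q powi k"
  by (simp add: tri_pow_def tri_add1 power_int_add)

lemma tri_pow_diff1: "tri_pow (k - 1) = tri_pow k * q / q powi k"
  using tri_pow_add1[of "k - 1"] by (simp add: power_int_diff field_simps)

lemma tri_pow_0 [simp]: "tri_pow 0 = 1" and tri_pow_1 [simp]: "tri_pow 1 = 1"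
  by (simp_all add: tri_pow_def)

lemma tri_pow_pos: "0 < tri_pow k"
  using q_pos by (simp add: tri_pow_def)

text \<open>Reciprocal \<open>q\<close>-factorial, extended by \<open>0\<close> to negative indices so that the
  shift rule below holds for all integers.\<close>

definition rfac :: "int \<Rightarrow> real" where
  "rfac i = (if i < 0 then 0 else 1 / qpoch q q (nat i))"

lemma rfac_diff1: "rfac (i - 1) = (1 - q powi i) * rfac i"
proof (cases "i \<le> 0")
  \<comment> \<open>For \<open>i < 0\<close> both sides are \<open>0\<close> by convention; for
    \<open>i = 0\<close> the factor \<open>1 - q powi 0\<close> is \<open>0\<close>.\<close>
  case True
  then show ?thesis by (cases "i = 0") (auto simp: rfac_def)
next
  case False
  define n where "n = nat (i - 1)"
  have i: "i = int (Suc n)" using False by (simp add: n_def)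
  have "1 - q ^ Suc n \<noteq> 0"
    using power_Suc_less_one[OF q_pos q_less_1, of n] by simp
  moreover have "nat (1 + int n) = Suc n" by simp
  ultimately show ?thesis
    using qpoch_pos[of n] unfolding i rfac_def power_int_of_nat
    by (simp add: qpoch_Suc del: power_Suc)
qed

text \<open>Fourier coefficients of the truncated weight, as predicted by the finite form of
  Jacobi's triple product: the \<open>q\<close>-factorials make up the \<open>q\<close>-binomial coefficient
  of \<open>2 * N\<close> over \<open>N + k\<close>.\<close>

definition fin_moment :: "nat \<Rightarrow> int \<Rightarrow> real" where
  "fin_moment N k = pi * (-1) powi k * tri_pow k * (1 + q powi k) *
     (qpoch q q (2 * N) / (1 + q ^ N)) * rfac (int N - k) * rfac (int N + k)"

text \<open>Multiplication by the next factor
  \<open>1 - 2 * q ^ N * cos (2 * \<theta>) + q ^ (2 * N)\<close> acts in this way on Fourier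
  coefficients. In terms of \<open>X = q ^ N\<close> and \<open>Q = q powi k\<close> the claim
  becomes the rational identity \<open>key\<close>.\<close>

lemma fin_moment_Suc:
  "fin_moment (Suc N) k = (1 + (q ^ N)\<^sup>2) * fin_moment N k
     - q ^ N * (fin_moment N (k + 1) + fin_moment N (k - 1))"
proof -
  define X where "X = q ^ N"
  define Q where "Q = q powi k"
  \<comment> \<open>\<open>R\<close> and \<open>S\<close> carry the largest indices that occur;
    \<open>rfac_diff1\<close> expresses the other reciprocal factorials through them.\<close>
  define R where "R = rfac (int N + 1 - k)"
  define S where "S = rfac (int N + 1 + k)"
  define A where "A = qpoch q q (2 * N)"
  define s where "s = (-1::real) powi k"
  have X: "0 < X" and Q: "0 < Q" using q_pos by (auto simp: X_def Q_def)
  have XN: "q powi int N = X" by (simp add: X_def)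
  have r1: "rfac (int N - k) = (1 - q * X / Q) * R"
    using rfac_diff1[of "int N + 1 - k"]
    by (simp add: R_def Q_def X_def power_int_diff power_int_add algebra_simps)
  have r2: "rfac (int N + k) = (1 - q * X * Q) * S"
    using rfac_diff1[of "int N + 1 + k"]
    by (simp add: S_def Q_def X_def power_int_diff power_int_add algebra_simps)
  have r3: "rfac (int N - (k + 1)) = (1 - X / Q) * ((1 - q * X / Q) * R)"
    using rfac_diff1[of "int N - k"] unfolding r1
    by (simp add: Q_def X_def power_int_diff power_int_add algebra_simps)
  have r4: "rfac (int N + (k - 1)) = (1 - X * Q) * ((1 - q * X * Q) * S)"
    using rfac_diff1[of "int N + k"] unfolding r2
    by (simp add: Q_def X_def power_int_diff power_int_add algebra_simps)
  have r5: "rfac (int N + (k + 1)) = S" "rfac (int (Suc N) + k) = S"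
     "rfac (int (Suc N) - k) = R" "rfac (int N - (k - 1)) = R"
    by (simp_all add: S_def R_def algebra_simps)
  have A: "qpoch q q (2 * Suc N) = A * (1 - q * X\<^sup>2) * (1 - q\<^sup>2 * X\<^sup>2)"
  proof -
    have "2 * Suc N = Suc (Suc (2 * N))" by simp
    moreover have "q ^ Suc (2 * N) = q * X\<^sup>2" "q ^ Suc (Suc (2 * N)) = q\<^sup>2 * X\<^sup>2"
      by (simp_all add: X_def power2_eq_square power_add mult_2)
    ultimately show ?thesis by (simp only: qpoch_Suc A_def)
  qed
  have s: "(-1::real) powi (k + 1) = - s" "(-1::real) powi (k - 1) = - s"
    by (simp_all add: s_def power_int_add power_int_diff)
  have Qs: "q powi (k + 1) = Q * q" "q powi (k - 1) = Q / q"
    by (simp_all add: Q_def power_int_add power_int_diff)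
  \<comment> \<open>The shifted terms enter with a plus sign, because \<open>(-1) powi k\<close>
    changes sign at \<open>k + 1\<close> and at \<open>k - 1\<close>.\<close>
  have key: "(1 + Q) * ((1 - q * X\<^sup>2) * (1 - q * X) * (1 + X)) =
      (1 + X\<^sup>2) * (1 + Q) * (1 - q * X / Q) * (1 - q * X * Q)
      + X * (Q * (1 + Q * q) * ((1 - X / Q) * (1 - q * X / Q))
        + q / Q * (1 + Q / q) * ((1 - X * Q) * (1 - q * X * Q)))"
    using Q by (simp add: field_simps power2_eq_square)
  have "fin_moment (Suc N) k = pi * s * tri_pow k * (A / (1 + X)) * R * S *
      ((1 + Q) * ((1 - q * X\<^sup>2) * (1 - q * X) * (1 + X)))"
  proof -
    have "0 < 1 + q * X" using X q_pos by (simp add: add_pos_pos)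
    moreover have "1 - q\<^sup>2 * X\<^sup>2 = (1 - q * X) * (1 + q * X)"
      by (simp add: power2_eq_square algebra_simps)
    ultimately have "(1 - q\<^sup>2 * X\<^sup>2) / (1 + q * X) = 1 - q * X" by simp
    then have "A * (1 - q * X\<^sup>2) * (1 - q\<^sup>2 * X\<^sup>2) / (1 + q * X)
        = A * (1 - q * X\<^sup>2) * (1 - q * X)" by (metis times_divide_eq_right)
    moreover have "q ^ Suc N = q * X" by (simp add: X_def)
    moreover have "1 + X \<noteq> 0" using X by simp
    ultimately show ?thesis
      unfolding fin_moment_def r5 A Q_def[symmetric] s_def[symmetric] by simp
  qed
  also have "\<dots> = (1 + X\<^sup>2) * fin_moment N k
     - X * (fin_moment N (k + 1) + fin_moment N (k - 1))"
  proof -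
    \<comment> \<open>Names for the quotients leave an identity that follows from ring laws
      alone.\<close>
    define h where "h = q / Q"
    define f where "f = 1 + Q / q"
    define g where "g = 1 + Q * q"
    define B where "B = A / (1 + X)"
    define d1 where "d1 = 1 - q * X / Q"
    define d2 where "d2 = 1 - q * X * Q"
    define d3 where "d3 = 1 - X / Q"
    define d4 where "d4 = 1 - X * Q"
    have e: "tri_pow (k - 1) = tri_pow k * h"
      by (simp add: tri_pow_diff1 h_def Q_def)
    show ?thesis
      unfolding key fin_moment_def r1 r2 r3 r4 r5 s Qs tri_pow_add1 e
        Q_def[symmetric] s_def[symmetric] A_def[symmetric] X_def[symmetric] h_def[symmetric]
        f_def[symmetric] g_def[symmetric] B_def[symmetric]
        d1_def[symmetric] d2_def[symmetric] d3_def[symmetric] d4_def[symmetric]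
      by (simp only: algebra_simps minus_mult_left[symmetric] minus_mult_right[symmetric] minus_minus)
  qed
  finally show ?thesis by (simp add: X_def)
qed

section \<open>Fourier coefficients of the truncated and of the infinite product\<close>

lemma integral_cos_int: "integral {0..pi} (\<lambda>\<theta>. cos (real_of_int j * \<theta>)) = (if j = 0 then pi else 0)"
proof (cases "j = 0")
  case False
  have "((\<lambda>\<theta>. cos (real_of_int j * \<theta>)) has_integral
      (sin (real_of_int j * pi) / j - sin (real_of_int j * 0) / j)) {0..pi}"
    using False
    by (intro fundamental_theorem_of_calculus)
      (auto intro!: derivative_eq_intros simp flip: has_real_derivative_iff_has_vector_derivative)
  then show ?thesis using False
    by (simp add: integral_unique mult.commute[of _ pi])
qed simp

text \<open>The factor added by \<open>qprod_Suc\<close> contains \<open>cos (2 * \<theta>)\<close>;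
  product-to-sum turns it into the shifts \<open>j + 2\<close> and \<open>j - 2\<close>, that is
  \<open>k + 1\<close> and \<open>k - 1\<close> for \<open>k = j div 2\<close>.\<close>

lemma integral_cos_qprod:
  "integral {0..pi} (\<lambda>\<theta>. cos (real_of_int j * \<theta>) * qprod q N 1 (cos (2 * \<theta>)))
    = (if even j then fin_moment N (j div 2) else 0)"
proof (induction N arbitrary: j)
  case 0
  show ?case by (auto simp: integral_cos_int fin_moment_def rfac_def qpoch_0)
next
  case (Suc N)
  let ?u = "\<lambda>j \<theta>. cos (real_of_int j * \<theta>) * qprod q N 1 (cos (2 * \<theta>))"
  have cont: "continuous_on {0..pi} (?u j)" for j
    by (intro continuous_intros)
  have "cos (real_of_int j * \<theta>) * qprod q (Suc N) 1 (cos (2 * \<theta>)) =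
    (1 + (q ^ N)\<^sup>2) * ?u j \<theta> + (- (q ^ N)) * ?u (j + 2) \<theta> + (- (q ^ N)) * ?u (j - 2) \<theta>" for \<theta>
  proof -
    have "real_of_int (j + 2) * \<theta> = real_of_int j * \<theta> + 2 * \<theta>"
       "real_of_int (j - 2) * \<theta> = real_of_int j * \<theta> - 2 * \<theta>"
      by (simp_all add: algebra_simps)
    then have "cos (real_of_int (j + 2) * \<theta>) + cos (real_of_int (j - 2) * \<theta>)
      = 2 * cos (real_of_int j * \<theta>) * cos (2 * \<theta>)"
      by (simp only: cos_add cos_diff)
    moreover have "(1 + (q ^ N)\<^sup>2) * ?u j \<theta> + (- (q ^ N)) * ?u (j + 2) \<theta> + (- (q ^ N)) * ?u (j - 2) \<theta>
       = qprod q N 1 (cos (2 * \<theta>)) * ((1 + (q ^ N)\<^sup>2) * cos (real_of_int j * \<theta>) - q ^ N *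
          (cos (real_of_int (j + 2) * \<theta>) + cos (real_of_int (j - 2) * \<theta>)))"
      by (simp only: algebra_simps)
    ultimately show ?thesis
      by (simp only: qprod_Suc) (simp add: algebra_simps)
  qed
  from integral_weight_lincomb[OF cos_weight_one cont cont cont this]
  have "integral {0..pi} (\<lambda>\<theta>. cos (real_of_int j * \<theta>) * qprod q (Suc N) 1 (cos (2 * \<theta>)))
     = (1 + (q ^ N)\<^sup>2) * integral {0..pi} (?u j) + (- (q ^ N)) * integral {0..pi} (?u (j + 2))
        + (- (q ^ N)) * integral {0..pi} (?u (j - 2))"
    by simp
  moreover have "(j + 2) div 2 = j div 2 + 1" "(j - 2) div 2 = j div 2 - 1" by auto
  ultimately show ?case
    unfolding Suc.IH by (auto simp: fin_moment_Suc algebra_simps)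
qed

lemma rfac_LIMSEQ: "(\<lambda>N. rfac (int N + k)) \<longlonglongrightarrow> 1 / qpoch_inf q q"
proof -
  have "(\<lambda>n. 1 / qpoch q q n) \<longlonglongrightarrow> 1 / qpoch_inf q q"
    using abs_q by (intro tendsto_intros qpoch_LIMSEQ qpoch_inf_nz) auto
  moreover have "filterlim (\<lambda>N. nat (int N + k)) at_top at_top"
    unfolding filterlim_at_top
  proof
    fix Z
    show "\<forall>\<^sub>F N in sequentially. Z \<le> nat (int N + k)"
      using eventually_ge_at_top[of "Z + nat (- k)"] by eventually_elim linarith
  qed
  ultimately have "(\<lambda>N. 1 / qpoch q q (nat (int N + k))) \<longlonglongrightarrow> 1 / qpoch_inf q q"
    by (rule filterlim_compose)
  moreover have "\<forall>\<^sub>F N in sequentially. 1 / qpoch q q (nat (int N + k)) = rfac (int N + k)"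
    using eventually_ge_at_top[of "nat (- k)"] by eventually_elim (auto simp: rfac_def)
  ultimately show ?thesis by (rule Lim_transform_eventually)
qed

text \<open>One \<open>q\<close>-factorial in the numerator and two in the denominator all tend to
  \<open>qpoch_inf q q\<close>, so one remains below.\<close>

lemma fin_moment_LIMSEQ:
  "(\<lambda>N. fin_moment N k) \<longlonglongrightarrow> pi * (-1) powi k * tri_pow k * (1 + q powi k) / qpoch_inf q q"
proof -
  have "(\<lambda>N. qpoch q q N) \<longlonglongrightarrow> qpoch_inf q q"
    using abs_q by (intro qpoch_LIMSEQ) auto
  then have 1: "(\<lambda>N. qpoch q q (2 * N)) \<longlonglongrightarrow> qpoch_inf q q"
    by (rule LIMSEQ_subseq_LIMSEQ[unfolded o_def]) (auto simp: strict_mono_def)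
  have 2: "(\<lambda>N. q ^ N) \<longlonglongrightarrow> 0"
    using abs_q by (intro LIMSEQ_power_zero) auto
  have 3: "(\<lambda>N. rfac (int N - k)) \<longlonglongrightarrow> 1 / qpoch_inf q q"
    using rfac_LIMSEQ[of "- k"] by simp
  have "(\<lambda>N. fin_moment N k) \<longlonglongrightarrow> pi * (-1) powi k * tri_pow k * (1 + q powi k) *
     (qpoch_inf q q / (1 + 0)) * (1 / qpoch_inf q q) * (1 / qpoch_inf q q)"
    unfolding fin_moment_def
    by (intro tendsto_intros 1 2 3 rfac_LIMSEQ) simp
  then show ?thesis using qpoch_inf_nz by simp
qed

definition herm_weight :: "real \<Rightarrow> real" where
  "herm_weight \<theta> = (cmod (qpoch_inf (cis (2 * \<theta>)) (complex_of_real q)))\<^sup>2"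

lemma cos_weight_herm: "cos_weight herm_weight"
  and integral_cos_herm_weight:
  "integral {0..pi} (\<lambda>\<theta>. cos (real_of_int j * \<theta>) * herm_weight \<theta>) =
    (if even j then pi * (-1) powi (j div 2) * tri_pow (j div 2) * (1 + q powi (j div 2)) / qpoch_inf q q
     else 0)"
proof -
  have bnd: "0 \<le> qprod q N 1 (cos (2 * \<theta>)) \<and> qprod q N 1 (cos (2 * \<theta>)) \<le> exp (2 * \<bar>1\<bar> / (1 - q))" for N \<theta>
    using q_pos q_less_1 by (intro conjI qprod_nonneg qprod_le) auto
  have lim: "(\<lambda>N. qprod q N 1 (cos (2 * \<theta>))) \<longlonglongrightarrow> herm_weight \<theta>" for \<theta>
    using qprod_LIMSEQ[OF abs_q, of 1 "2 * \<theta>"] by (simp add: herm_weight_def)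
  have cont: "continuous_on {0..pi} (\<lambda>\<theta>. qprod q N 1 (cos (2 * \<theta>)))" for N
    by (intro continuous_intros)
  note L = cos_weight_limit[OF cos_weight_one cont bnd lim]
  show "cos_weight herm_weight" using L(1) by simp
  have "continuous_on {0..pi} (\<lambda>\<theta>. cos (real_of_int j * \<theta>))"
    by (intro continuous_intros)
  from L(2)[OF this]
  have "(\<lambda>N. if even j then fin_moment N (j div 2) else 0) \<longlonglongrightarrow>
     integral {0..pi} (\<lambda>\<theta>. cos (real_of_int j * \<theta>) * herm_weight \<theta>)"
    by (simp add: integral_cos_qprod)
  moreover have "(\<lambda>N. if even j then fin_moment N (j div 2) else 0) \<longlonglongrightarrow>
    (if even j then pi * (-1) powi (j div 2) * tri_pow (j div 2) * (1 + q powi (j div 2)) / qpoch_inf q q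
     else 0)"
    by (auto intro: fin_moment_LIMSEQ)
  ultimately show "integral {0..pi} (\<lambda>\<theta>. cos (real_of_int j * \<theta>) * herm_weight \<theta>) =
    (if even j then pi * (-1) powi (j div 2) * tri_pow (j div 2) * (1 + q powi (j div 2)) / qpoch_inf q q
     else 0)"
    by (rule LIMSEQ_unique)
qed


text \<open>Coefficient extraction: by Jacobi's triple product \<open>herm_weight\<close> is, up to a constant,
  the symmetrisation of \<open>\<Sum>k. (-1) ^ k * q ^ (k * (k - 1) / 2) * z ^ (2 * k)\<close> with \<open>z = exp (\<i> * \<theta>)\<close>,
  and \<open>herm_coeff n j\<close> is the constant term of its product with \<open>z ^ j\<close> and the \<open>n\<close>-th
  \<open>q\<close>-Hermite polynomial.\<close>

definition herm_prod :: "nat \<Rightarrow> int \<Rightarrow> real" where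
  "herm_prod n l = (-1) powi l * tri_pow (l + 1) * (\<Prod>i<n. 1 - q powi (int i - l))"

definition herm_coeff :: "nat \<Rightarrow> int \<Rightarrow> real" where
  "herm_coeff n j = (if even (int n + j) then herm_prod n ((int n + j) div 2) else 0)"

text \<open>For \<open>n > 0\<close> all products share the factors collected in \<open>D\<close>,
  and the signs and powers of \<open>q\<close> agree up to \<open>-1\<close> and
  \<open>Q = q powi l\<close>; an identity in \<open>Q\<close> and \<open>q ^ n\<close>
  remains.\<close>

lemma herm_prod_Suc:
  "herm_prod (Suc n) l = herm_prod n l + herm_prod n (l - 1) - (1 - q ^ n) * herm_prod (n - 1) (l - 1)"
proof (cases n)
  case 0
  then show ?thesis
    using tri_pow_add1[of l]
    by (simp add: herm_prod_def power_int_diff power_int_minus field_simps)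
next
  case (Suc m)
  define D where "D = (\<Prod>i<m. 1 - q powi (int i - (l - 1)))"
  define Q where "Q = q powi l"
  have shift: "(\<Prod>i<Suc k. 1 - q powi (int i - l)) = (1 - 1 / Q) * (\<Prod>i<k. 1 - q powi (int i - (l - 1)))" for k
    by (subst prod.lessThan_Suc_shift) (simp add: Q_def power_int_minus field_simps)
  have D1: "(\<Prod>i<n. 1 - q powi (int i - (l - 1))) = D * (1 - q ^ n / Q)"
    by (simp add: Suc D_def Q_def power_int_diff power_int_add algebra_simps)
  have D2: "(\<Prod>i<n. 1 - q powi (int i - l)) = (1 - 1 / Q) * D"
    unfolding Suc shift D_def ..
  have D3: "(\<Prod>i<Suc n. 1 - q powi (int i - l)) = (1 - 1 / Q) * (D * (1 - q ^ n / Q))"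
    unfolding shift D1 ..
  have D4: "(\<Prod>i<n - 1. 1 - q powi (int i - (l - 1))) = D"
    by (simp add: Suc D_def)
  have s: "(-1::real) powi (l - 1) = - ((-1) powi l)"
    by (simp add: power_int_diff)
  have t: "tri_pow (l - 1 + 1) = tri_pow l" by simp
  \<comment> \<open>Separates the common factor \<open>s * e\<close> from the relation between the
    products.\<close>
  have reassoc: "s * (e * Q) * X3 = s * (e * Q) * X2 + - s * e * X1 - c * (- s * e * D)"
    if "Q * X3 = Q * X2 - X1 + c * D" for X1 X2 X3 s e c :: real
    using arg_cong[OF that, of "\<lambda>x. s * e * x"] by (simp add: algebra_simps)
  have "Q \<noteq> 0" by (simp add: Q_def)
  then have "Q * ((1 - 1 / Q) * (D * (1 - q ^ n / Q)))
      = Q * ((1 - 1 / Q) * D) - D * (1 - q ^ n / Q) + (1 - q ^ n) * D"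
    by (simp add: field_simps)
  then show ?thesis
    unfolding herm_prod_def D1 D2 D3 D4 s t tri_pow_add1[of l] Q_def[symmetric]
    by (rule reassoc)
qed

text \<open>As \<open>2 * x = z + 1 / z\<close>, the three-term recurrence shifts the exponent
  \<open>j\<close> by one in both directions.\<close>

lemma herm_coeff_Suc:
  "herm_coeff (Suc n) j = herm_coeff n (j + 1) + herm_coeff n (j - 1) - (1 - q ^ n) * herm_coeff (n - 1) j"
proof (cases "even (int (Suc n) + j)")
  case True
  then obtain l where l: "int (Suc n) + j = 2 * l" by (elim evenE)
  have j: "j = 2 * l - int n - 1" using l by simp
  have 1: "herm_coeff (Suc n) j = herm_prod (Suc n) l" "herm_coeff n (j + 1) = herm_prod n l"
    "herm_coeff n (j - 1) = herm_prod n (l - 1)"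
    by (auto simp: herm_coeff_def j)
  \<comment> \<open>At \<open>n = 0\<close> the truncated \<open>n - 1\<close> has the wrong parity,
    but \<open>1 - q ^ 0\<close> makes both sides \<open>0\<close>.\<close>
  have "(1 - q ^ n) * herm_coeff (n - 1) j = (1 - q ^ n) * herm_prod (n - 1) (l - 1)"
    by (cases n) (auto simp: herm_coeff_def j)
  then show ?thesis unfolding 1 herm_prod_Suc by linarith
next
  case False
  then show ?thesis by (cases n) (auto simp: herm_coeff_def)
qed

text \<open>The terms at \<open>j\<close> and \<open>- j\<close> come from writing
  \<open>cos (j * \<theta>)\<close> as half the sum of \<open>z ^ j\<close> and
  \<open>z ^ (- j)\<close>. The induction treats all \<open>j\<close> at once, because a step in
  \<open>n\<close> moves \<open>j\<close>.\<close>

lemma integral_qHermite_cos: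
  "integral {0..pi} (\<lambda>\<theta>. (big_qHermite 0 q n (cos \<theta>) * cos (real_of_int j * \<theta>)) * herm_weight \<theta>)
    = pi / qpoch_inf q q * (herm_coeff n j + herm_coeff n (- j))"
proof (induction n arbitrary: j rule: less_induct)
  case (less n)
  show ?case
  proof (cases n)
    case 0
    \<comment> \<open>The coefficients at \<open>2 * l\<close> and \<open>- (2 * l)\<close> differ
      by the factor \<open>q powi l\<close>, which produces the \<open>1 + q powi l\<close> in the
      moments of \<open>herm_weight\<close>.\<close>
    have "tri_pow (1 - l) = tri_pow l" for l
      using tri_minus[of "l - 1"] by (simp add: tri_pow_def)
    then have "herm_coeff 0 (- (2 * l)) = (-1) powi l * tri_pow l" for l
      by (simp add: herm_coeff_def herm_prod_def power_int_minus_left add.commute flip: mult_minus_right)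
    moreover have "herm_coeff 0 (2 * l) = (-1) powi l * tri_pow l * q powi l" for l
      by (simp add: herm_coeff_def herm_prod_def tri_pow_add1)
    moreover have "herm_coeff 0 j = 0" "herm_coeff 0 (- j) = 0" if "odd j"
      using that by (auto simp: herm_coeff_def)
    moreover have "integral {0..pi} (\<lambda>\<theta>. big_qHermite 0 q n (cos \<theta>) * cos (real_of_int j * \<theta>) * herm_weight \<theta>)
        = integral {0..pi} (\<lambda>\<theta>. cos (real_of_int j * \<theta>) * herm_weight \<theta>)"
      by (simp add: 0)
    ultimately show ?thesis
      unfolding integral_cos_herm_weight 0
      by (cases "even j") (auto simp: distrib_left add_divide_distrib elim!: evenE)
  next
    case (Suc k)
    let ?I = "\<lambda>n j. integral {0..pi} (\<lambda>\<theta>. (big_qHermite 0 q n (cos \<theta>) * cos (real_of_int j * \<theta>)) * herm_weight \<theta>)"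
    have c: "continuous_on {0..pi} (\<lambda>\<theta>. cos (real_of_int j * \<theta>))" for j
      by (intro continuous_intros)
    have cc: "continuous_on {0..pi} (\<lambda>\<theta>. big_qHermite 0 q k (cos \<theta>) * cos (real_of_int j * \<theta>))" for j
      by (intro continuous_intros)
    have "2 * cos \<theta> * big_qHermite 0 q k (cos \<theta>) * cos (real_of_int j * \<theta>)
      = 1 * (big_qHermite 0 q k (cos \<theta>) * cos (real_of_int (j + 1) * \<theta>))
        + 1 * (big_qHermite 0 q k (cos \<theta>) * cos (real_of_int (j - 1) * \<theta>))
        + 0 * (big_qHermite 0 q k (cos \<theta>) * cos (real_of_int 0 * \<theta>))" for \<theta>
    proof -
      have "real_of_int (j + 1) * \<theta> = real_of_int j * \<theta> + \<theta>"
         "real_of_int (j - 1) * \<theta> = real_of_int j * \<theta> - \<theta>"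
        by (simp_all add: algebra_simps)
      then show ?thesis by (simp only: cos_add cos_diff) (simp add: algebra_simps)
    qed
    from integral_weight_lincomb[OF cos_weight_herm cc cc cc this]
    have "?I (Suc k) j = ?I k (j + 1) + ?I k (j - 1) - (1 - q ^ k) * ?I (k - 1) j"
      using integral_mult_big_qHermite[OF cos_weight_herm c, of 0 q k j]
      by (simp del: big_qHermite.simps)
    moreover have "?I k (j + 1) = pi / qpoch_inf q q * (herm_coeff k (j + 1) + herm_coeff k (- j - 1))"
      "?I k (j - 1) = pi / qpoch_inf q q * (herm_coeff k (j - 1) + herm_coeff k (- j + 1))"
      using less.IH[of k "j + 1"] less.IH[of k "j - 1"] Suc by simp_all
    moreover have "?I (k - 1) j = pi / qpoch_inf q q * (herm_coeff (k - 1) j + herm_coeff (k - 1) (- j))"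
      using less.IH[of "k - 1" j] Suc by simp
    ultimately have "?I (Suc k) j = pi / qpoch_inf q q * (herm_coeff (Suc k) j + herm_coeff (Suc k) (- j))"
      unfolding herm_coeff_Suc by (simp only: algebra_simps)
    then show ?thesis by (simp only: Suc)
  qed
qed

text \<open>The total mass of \<open>herm_weight\<close>, and the reciprocal of the prefactor in the
  final formula.\<close>

definition herm_mass :: real where
  "herm_mass = 2 * pi / qpoch_inf q q"

text \<open>For \<open>n = 2 * l > 0\<close> the product in \<open>herm_prod n l\<close> contains
  the factor \<open>1 - q powi 0\<close> at \<open>i = l\<close>; odd \<open>n\<close> drop out by
  parity.\<close>

lemma integral_qHermite:
  "integral {0..pi} (\<lambda>\<theta>. big_qHermite 0 q n (cos \<theta>) * herm_weight \<theta>)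
    = herm_mass * (if n = 0 then 1 else 0)"
proof -
  have "herm_coeff n 0 = (if n = 0 then 1 else 0)"
  proof (cases "even n \<and> n \<noteq> 0")
    case True
    then obtain l where l: "n = 2 * l" "l < n" by (auto elim!: evenE)
    have "(\<Prod>i<n. 1 - q powi (int i - int l)) = 0"
      using l by (intro prod_zero bexI[of _ l]) auto
    then show ?thesis using l by (auto simp: herm_coeff_def herm_prod_def)
  qed (auto simp: herm_coeff_def herm_prod_def)
  then show ?thesis
    using integral_qHermite_cos[of n 0] by (simp add: herm_mass_def)
qed


end

section \<open>The series on the right-hand side\<close>

context q_base
begin

definition phi_coeff :: "nat \<Rightarrow> real" where
  "phi_coeff k = q ^ (k * (k - 1)) / qpoch q q k"

lemma phi_coeff_pos: "0 < phi_coeff k"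
  using q_pos qpoch_pos by (simp add: phi_coeff_def)

lemma phi_coeff_Suc: "phi_coeff (Suc k) * (1 - q ^ Suc k) = q ^ (2 * k) * phi_coeff k"
proof -
  have "1 - q ^ Suc k \<noteq> 0"
    using power_Suc_less_one[OF q_pos q_less_1, of k] by simp
  moreover have "Suc k * (Suc k - 1) = 2 * k + k * (k - 1)"
    by (cases k) simp_all
  then have "q ^ (Suc k * (Suc k - 1)) = q ^ (2 * k) * q ^ (k * (k - 1))"
    by (simp only: power_add)
  ultimately show ?thesis
    using qpoch_pos[of k] unfolding phi_coeff_def qpoch_Suc
    by (simp del: power_Suc)
qed

definition phi :: "real \<Rightarrow> real" where
  "phi y = qphi01 0 q y"

text \<open>The ratio of consecutive terms is at most \<open>\<bar>y\<bar> * q ^ k / (1 - q)\<close>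
  in modulus and tends to \<open>0\<close>. Large \<open>y\<close> do occur: the final argument
  grows with \<open>m + n\<close>.\<close>

lemma summable_phi: "summable (\<lambda>k. phi_coeff k * y ^ k)"
proof -
  have "(\<lambda>k. q ^ k) \<longlonglongrightarrow> 0"
    using abs_q by (intro LIMSEQ_power_zero) auto
  then have "(\<lambda>k. \<bar>y\<bar> * q ^ k / (1 - q)) \<longlonglongrightarrow> \<bar>y\<bar> * 0 / (1 - q)"
    using q_less_1 abs_q by (intro tendsto_intros) auto
  then have "\<forall>\<^sub>F k in sequentially. \<bar>y\<bar> * q ^ k / (1 - q) < 1 / 2"
    by (rule order_tendstoD) simp
  then obtain K where K: "\<And>k. k \<ge> K \<Longrightarrow> \<bar>y\<bar> * q ^ k / (1 - q) < 1 / 2"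
    by (auto simp: eventually_sequentially)
  show ?thesis
  proof (rule summable_ratio_test[of "1 / 2" K])
    fix k assume "K \<le> k"
    have "q ^ Suc k \<le> q" using power_decreasing[of 1 "Suc k" q] q_pos q_less_1 by simp
    then have d: "1 - q \<le> 1 - q ^ Suc k" by simp
    have "phi_coeff (Suc k) * (1 - q) \<le> phi_coeff (Suc k) * (1 - q ^ Suc k)"
      using d phi_coeff_pos[of "Suc k"] by (intro mult_left_mono) auto
    also have "\<dots> \<le> q ^ k * phi_coeff k"
      unfolding phi_coeff_Suc using q_pos q_less_1 phi_coeff_pos[of k]
      by (intro mult_right_mono power_decreasing) auto
    finally have "phi_coeff (Suc k) \<le> q ^ k / (1 - q) * phi_coeff k"
      using q_less_1 by (simp add: field_simps)
    then have "phi_coeff (Suc k) * \<bar>y\<bar> \<le> q ^ k / (1 - q) * phi_coeff k * \<bar>y\<bar>"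
      by (intro mult_right_mono) auto
    also have "\<dots> = (\<bar>y\<bar> * q ^ k / (1 - q)) * phi_coeff k" by simp
    also have "\<dots> \<le> 1 / 2 * phi_coeff k"
      using K[OF \<open>K \<le> k\<close>] phi_coeff_pos[of k] by (intro mult_right_mono) auto
    finally have "phi_coeff (Suc k) * \<bar>y\<bar> * \<bar>y\<bar> ^ k \<le> 1 / 2 * phi_coeff k * \<bar>y\<bar> ^ k"
      by (intro mult_right_mono) auto
    then show "norm (phi_coeff (Suc k) * y ^ Suc k) \<le> 1 / 2 * norm (phi_coeff k * y ^ k)"
      using phi_coeff_pos[of k] phi_coeff_pos[of "Suc k"]
      by (simp add: abs_mult power_abs mult.assoc)
  qed simp
qed

lemma phi_sums: "(\<lambda>k. phi_coeff k * y ^ k) sums phi y"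
  using summable_sums[OF summable_phi[of y]]
  by (simp add: phi_def qphi01_def phi_coeff_def qpoch_def)

text \<open>In the difference \<open>phi y - phi (q * y)\<close> the constant terms cancel, and
  \<open>phi_coeff_Suc\<close> absorbs the factor \<open>1 - q ^ Suc k\<close>. All closed forms
  below rest on this equation.\<close>

lemma phi_q_difference: "phi y = phi (q * y) + y * phi (q\<^sup>2 * y)"
proof -
  have "(\<lambda>k. phi_coeff k * y ^ k - phi_coeff k * (q * y) ^ k) sums (phi y - phi (q * y))"
    by (intro sums_diff phi_sums)
  then have "(\<lambda>k. phi_coeff (Suc k) * y ^ Suc k - phi_coeff (Suc k) * (q * y) ^ Suc k)
      sums (phi y - phi (q * y))"
    by (subst sums_Suc_iff) simp
  moreover have "phi_coeff (Suc k) * y ^ Suc k - phi_coeff (Suc k) * (q * y) ^ Suc k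
      = y * (phi_coeff k * (q\<^sup>2 * y) ^ k)" for k
  proof -
    have "phi_coeff (Suc k) * y ^ Suc k - phi_coeff (Suc k) * (q * y) ^ Suc k
        = (phi_coeff (Suc k) * (1 - q ^ Suc k)) * y ^ Suc k"
      by (simp add: power_mult_distrib algebra_simps)
    moreover have "(q\<^sup>2 * y) ^ k = q ^ (2 * k) * y ^ k"
      by (simp only: power_mult_distrib power_mult)
    ultimately show ?thesis
      unfolding phi_coeff_Suc by simp
  qed
  ultimately have 1: "(\<lambda>k. y * (phi_coeff k * (q\<^sup>2 * y) ^ k)) sums (phi y - phi (q * y))" by simp
  have 2: "(\<lambda>k. y * (phi_coeff k * (q\<^sup>2 * y) ^ k)) sums (y * phi (q\<^sup>2 * y))"
    by (intro sums_mult phi_sums)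
  show ?thesis
    using sums_unique2[OF 1 2] by simp
qed

lemma phi_mono: 
  assumes "0 \<le> y" "y \<le> z" shows "phi y \<le> phi z"
  using assms phi_coeff_pos
  by (intro sums_le[OF _ phi_sums phi_sums] mult_left_mono power_mono) (auto simp: less_imp_le)

lemma phi_0: "phi 0 = 1"
  using sums_unique2[OF phi_sums powser_sums_zero] by (simp add: phi_coeff_def qpoch_def)

text \<open>Termwise \<open>y ^ Suc k \<le> y\<close> on the unit interval. The linear rate makes
  the error at \<open>t * q ^ N\<close> vanish in the limit.\<close>

lemma phi_minus_1_le:
  assumes "0 \<le> y" "y \<le> 1" shows "phi y - 1 \<le> y * phi 1"
proof -
  have S: "(\<lambda>k. phi_coeff (Suc k) * x ^ Suc k) sums (phi x - 1)" for x
    using phi_sums[of x] by (subst sums_Suc_iff) (simp add: phi_coeff_def qpoch_def)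
  have T: "(\<lambda>k. y * (phi_coeff (Suc k) * 1 ^ Suc k)) sums (y * (phi 1 - 1))"
    by (intro sums_mult S)
  have "phi_coeff (Suc k) * y ^ Suc k \<le> y * (phi_coeff (Suc k) * 1 ^ Suc k)" for k
  proof -
    have "y ^ k \<le> 1" using assms by (simp add: power_le_one)
    then show ?thesis
      using assms phi_coeff_pos[of "Suc k"]
      by (simp add: mult_le_cancel_left_pos mult_left_le mult_left_mono mult.commute)
  qed
  then have "phi y - 1 \<le> y * (phi 1 - 1)"
    by (rule sums_le[OF _ S T])
  then show ?thesis using assms by (simp add: algebra_simps)
qed

section \<open>Adding the second factor of the weight\<close>

text \<open>The closed form of \<open>J n t\<close> divided by \<open>herm_mass\<close>, as
  established in \<open>integral_qHermite_shift\<close>.\<close>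

definition herm_shifted :: "nat \<Rightarrow> real \<Rightarrow> real" where
  "herm_shifted n t = (- t) ^ n * tri_pow (int n) * phi (q ^ n * t\<^sup>2)"

text \<open>With \<open>y = q ^ n * t\<^sup>2\<close>, this is \<open>phi_q_difference\<close> used
  at \<open>y\<close> and at \<open>q * y\<close>. It has the form of
  \<open>fin_shifted_Suc\<close>.\<close>

lemma herm_shifted_rec:
  "herm_shifted n t = (1 + t\<^sup>2) * herm_shifted n (t * q)
     - t * (herm_shifted (Suc n) (t * q) + (1 - q ^ n) * herm_shifted (n - 1) (t * q))"
proof -
  define X where "X = q ^ n"
  define y where "y = X * t\<^sup>2"
  define c where "c = (- t) ^ n * tri_pow (int n)"
  have a0: "herm_shifted n t = c * phi y"
    by (simp add: herm_shifted_def c_def y_def X_def)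
  have a1: "herm_shifted n (t * q) = c * X * phi (q\<^sup>2 * y)"
  proof -
    have "(- (t * q)) ^ n = (- t) ^ n * X" 
      using power_mult_distrib[of "- t" q n] by (simp add: X_def)
    then show ?thesis
      by (simp add: herm_shifted_def c_def y_def X_def power_mult_distrib mult_ac)
  qed
  have a2: "t * herm_shifted (Suc n) (t * q) = - (c * X * q * X * t\<^sup>2 * phi (q\<^sup>2 * (q * y)))"
  proof -
    have "(- (t * q)) ^ n = (- t) ^ n * X" 
      using power_mult_distrib[of "- t" q n] by (simp add: X_def)
    moreover have "tri_pow (int (Suc n)) = tri_pow (int n) * X"
      using tri_pow_add1[of "int n"] by (simp add: X_def add.commute)
    ultimately show ?thesis
      by (simp add: herm_shifted_def c_def y_def X_def power_mult_distrib power2_eq_square mult_ac)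
  qed
  have a3: "t * ((1 - X) * herm_shifted (n - 1) (t * q)) = - ((1 - X) * c * phi (q * y))"
  proof (cases n)
    case (Suc m)
    have "(- (t * q)) ^ m = (- t) ^ m * q ^ m"
      using power_mult_distrib[of "- t" q m] by simp
    moreover have "tri_pow (int (Suc m)) = tri_pow (int m) * q ^ m"
      using tri_pow_add1[of "int m"] by (simp add: add.commute)
    ultimately show ?thesis
      by (simp add: Suc herm_shifted_def c_def y_def X_def power_mult_distrib power2_eq_square mult_ac)
  qed (simp add: X_def)
  have p1: "phi y = phi (q * y) + y * phi (q\<^sup>2 * y)"
    by (rule phi_q_difference)
  have p2: "phi (q * y) = phi (q\<^sup>2 * y) + q * y * phi (q\<^sup>2 * (q * y))"
    using phi_q_difference[of "q * y"] by (simp add: power2_eq_square mult_ac)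
  have "(1 + t\<^sup>2) * (c * X * phi (q\<^sup>2 * y)) + c * X * q * X * t\<^sup>2 * phi (q\<^sup>2 * (q * y))
      + (1 - X) * c * phi (q * y) 
    = c * X * (phi (q\<^sup>2 * y) + q * y * phi (q\<^sup>2 * (q * y))) + c * y * phi (q\<^sup>2 * y)
      + (1 - X) * c * phi (q * y)"
    by (simp add: y_def algebra_simps)
  also have "\<dots> = c * phi y"
    unfolding p2[symmetric] p1 by (simp add: algebra_simps)
  finally show ?thesis
    unfolding a0 a1 X_def[symmetric] distrib_left a2 a3 by simp
qed

lemma tri_pow_le_1: "tri_pow (int n) \<le> 1"
  unfolding tri_pow_def tri_int power_int_of_nat
  using q_pos q_less_1 by (simp add: power_le_one)

text \<open>Uniformity in \<open>n\<close> matters, since the recurrence couples neighbouring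
  \<open>n\<close>. For \<open>n > 0\<close> the smallness comes from \<open>(- t) ^ n\<close>, for
  \<open>n = 0\<close> from \<open>phi_minus_1_le\<close>.\<close>

lemma herm_shifted_near_0:
  assumes "\<bar>t\<bar> \<le> 1"
  shows "\<bar>herm_shifted n t - (if n = 0 then 1 else 0)\<bar> \<le> \<bar>t\<bar> * phi 1"
proof -
  have t2: "0 \<le> t\<^sup>2" "t\<^sup>2 \<le> \<bar>t\<bar>" "t\<^sup>2 \<le> 1"
    using assms mult_left_le[of "\<bar>t\<bar>" "\<bar>t\<bar>"] by (auto simp: power2_eq_square abs_mult_self_eq)
  have phi1: "1 \<le> phi y" if "0 \<le> y" for y using phi_mono[of 0 y] phi_0 that by simp
  show ?thesis
  proof (cases n)
    case 0
    have "phi (t\<^sup>2) - 1 \<le> t\<^sup>2 * phi 1" using t2 by (intro phi_minus_1_le)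
    also have "\<dots> \<le> \<bar>t\<bar> * phi 1" using t2 phi1[of 1] by (intro mult_right_mono) auto
    finally show ?thesis using phi1[of "t\<^sup>2"] by (simp add: 0 herm_shifted_def)
  next
    case (Suc m)
    have "\<bar>(- t) ^ n\<bar> \<le> \<bar>t\<bar>"
      using assms mult_left_le[of "\<bar>t\<bar> ^ m" "\<bar>t\<bar>"] by (simp add: Suc abs_mult power_abs power_le_one)
    moreover have "q ^ n * t\<^sup>2 \<le> 1 * 1"
      using t2 q_pos q_less_1 by (intro mult_mono) (auto simp: power_le_one)
    then have "phi (q ^ n * t\<^sup>2) \<le> phi 1" using q_pos by (intro phi_mono) auto
    moreover have "0 \<le> phi (q ^ n * t\<^sup>2)" using phi1[of "q ^ n * t\<^sup>2"] q_pos by simp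
    ultimately have "\<bar>(- t) ^ n\<bar> * tri_pow (int n) * phi (q ^ n * t\<^sup>2) \<le> \<bar>t\<bar> * 1 * phi 1"
      using tri_pow_le_1[of n] tri_pow_pos[of "int n"] by (intro mult_mono) auto
    then show ?thesis using \<open>0 \<le> phi (q ^ n * t\<^sup>2)\<close> tri_pow_pos[of "int n"]
      by (simp add: Suc herm_shifted_def abs_mult)
  qed
qed

text \<open>\<open>J n t\<close> with the second factor of the weight truncated to \<open>N\<close>
  factors.\<close>

definition fin_shifted :: "nat \<Rightarrow> nat \<Rightarrow> real \<Rightarrow> real" where
  "fin_shifted N n t = integral {0..pi}
     (\<lambda>\<theta>. (big_qHermite 0 q n (cos \<theta>) * qprod q N t (cos \<theta>)) * herm_weight \<theta>)"

text \<open>After \<open>qprod_Suc_shift\<close>, the polynomial absorbs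
  \<open>2 * cos \<theta>\<close>; its parameter is \<open>0\<close>, so the term
  \<open>a * q ^ n\<close> disappears.\<close>

lemma fin_shifted_Suc:
  "fin_shifted (Suc N) n t = (1 + t\<^sup>2) * fin_shifted N n (t * q)
     - t * (fin_shifted N (Suc n) (t * q) + (1 - q ^ n) * fin_shifted N (n - 1) (t * q))"
proof -
  let ?u = "\<lambda>\<theta>. big_qHermite 0 q n (cos \<theta>) * qprod q N (t * q) (cos \<theta>)"
  have c: "continuous_on {0..pi} (\<lambda>\<theta>. qprod q N (t * q) (cos \<theta>))"
    and cu: "continuous_on {0..pi} ?u"
    and cx: "continuous_on {0..pi} (\<lambda>\<theta>. 2 * cos \<theta> * big_qHermite 0 q n (cos \<theta>) * qprod q N (t * q) (cos \<theta>))"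
    by (intro continuous_intros)+
  have "big_qHermite 0 q n (cos \<theta>) * qprod q (Suc N) t (cos \<theta>) = (1 + t\<^sup>2) * ?u \<theta>
    + (- t) * (2 * cos \<theta> * big_qHermite 0 q n (cos \<theta>) * qprod q N (t * q) (cos \<theta>)) + 0 * ?u \<theta>" for \<theta>
    by (simp add: qprod_Suc_shift algebra_simps)
  note lin = integral_weight_lincomb[OF cos_weight_herm cu cx cu this]
  show ?thesis
    unfolding fin_shifted_def lin integral_mult_big_qHermite[OF cos_weight_herm c, of 0 q n]
    by (simp del: big_qHermite.simps)
qed

text \<open>Both sides obey the same recurrence, whose operator norm with respect to the supremum
  over \<open>n\<close> is at most \<open>(1 + \<bar>t\<bar>) ^ 2 = qprod q 1 (- \<bar>t\<bar>) 1\<close>.\<close>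

lemma fin_shifted_error:
  assumes "\<And>n. \<bar>fin_shifted 0 n (t * q ^ N) - herm_mass * herm_shifted n (t * q ^ N)\<bar> \<le> \<epsilon>"
  shows "\<bar>fin_shifted N n t - herm_mass * herm_shifted n t\<bar> \<le> qprod q N (- \<bar>t\<bar>) 1 * \<epsilon>"
  using assms
proof (induction N arbitrary: t n)
  case (Suc N)
  define d where "d n = fin_shifted N n (t * q) - herm_mass * herm_shifted n (t * q)" for n
  define B where "B = qprod q N (- \<bar>t * q\<bar>) 1 * \<epsilon>"
  have d: "\<bar>d n\<bar> \<le> B" for n
    unfolding d_def B_def by (rule Suc.IH) (use Suc.prems in \<open>simp add: mult.assoc\<close>)
  then have "0 \<le> B" by (meson abs_ge_zero order_trans)
  have "0 \<le> 1 - q ^ n" "1 - q ^ n \<le> 1" using q_pos q_less_1 by (auto simp: power_le_one)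
  then have d': "\<bar>(1 - q ^ n) * d (n - 1)\<bar> \<le> B"
    using mult_mono[of "1 - q ^ n" 1 "\<bar>d (n - 1)\<bar>" B] d[of "n - 1"] by (simp add: abs_mult)
  have "fin_shifted (Suc N) n t - herm_mass * herm_shifted n t
      = (1 + t\<^sup>2) * d n - t * (d (Suc n) + (1 - q ^ n) * d (n - 1))"
    unfolding fin_shifted_Suc herm_shifted_rec[of n t] d_def by (simp add: algebra_simps)
  also have "\<bar>\<dots>\<bar> \<le> (1 + t\<^sup>2) * \<bar>d n\<bar> + \<bar>t\<bar> * (\<bar>d (Suc n)\<bar> + \<bar>(1 - q ^ n) * d (n - 1)\<bar>)"
  proof -
    have "\<bar>(1 + t\<^sup>2) * d n\<bar> = (1 + t\<^sup>2) * \<bar>d n\<bar>" by (simp add: abs_mult)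
    moreover have "\<bar>t * (d (Suc n) + (1 - q ^ n) * d (n - 1))\<bar>
        \<le> \<bar>t\<bar> * (\<bar>d (Suc n)\<bar> + \<bar>(1 - q ^ n) * d (n - 1)\<bar>)"
      unfolding abs_mult[of t] by (intro mult_left_mono abs_triangle_ineq) auto
    ultimately show ?thesis by linarith
  qed
  also have "\<dots> \<le> (1 + t\<^sup>2) * B + \<bar>t\<bar> * (B + B)"
    by (intro add_mono mult_left_mono d d') auto
  also have "\<dots> = qprod q (Suc N) (- \<bar>t\<bar>) 1 * \<epsilon>"
  proof -
    have "\<bar>t * q\<bar> = \<bar>t\<bar> * q" using q_pos by (simp add: abs_mult)
    then show ?thesis
      unfolding B_def qprod_Suc_shift by (simp add: algebra_simps)
  qed
  finally show ?case .
qed simp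

definition shift_weight :: "real \<Rightarrow> real \<Rightarrow> real" where
  "shift_weight t \<theta> =
     (cmod (qpoch_inf (complex_of_real t * cis \<theta>) (complex_of_real q)))\<^sup>2 * herm_weight \<theta>"

lemma cos_weight_shift: "cos_weight (shift_weight t)"
  and fin_shifted_LIMSEQ:
    "(\<lambda>N. fin_shifted N n t) \<longlonglongrightarrow>
       integral {0..pi} (\<lambda>\<theta>. big_qHermite 0 q n (cos \<theta>) * shift_weight t \<theta>)"
proof -
  have bnd: "0 \<le> qprod q N t (cos \<theta>) \<and> qprod q N t (cos \<theta>) \<le> exp (2 * \<bar>t\<bar> / (1 - q))" for N \<theta>
    using q_pos q_less_1 by (intro conjI qprod_nonneg qprod_le) auto
  have cont: "continuous_on {0..pi} (\<lambda>\<theta>. qprod q N t (cos \<theta>))" for N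
    by (intro continuous_intros)
  note L = cos_weight_limit[OF cos_weight_herm cont bnd qprod_LIMSEQ[OF abs_q]]
  show "cos_weight (shift_weight t)" using L(1) by (simp add: shift_weight_def[abs_def])
  have "continuous_on {0..pi} (\<lambda>\<theta>. big_qHermite 0 q n (cos \<theta>))"
    by (intro continuous_intros)
  from L(2)[OF this]
  show "(\<lambda>N. fin_shifted N n t) \<longlonglongrightarrow>
       integral {0..pi} (\<lambda>\<theta>. big_qHermite 0 q n (cos \<theta>) * shift_weight t \<theta>)"
    by (simp add: fin_shifted_def shift_weight_def)
qed

text \<open>At \<open>t * q ^ N\<close> with no factor left, orthogonality is exact and the closed
  form is off by a multiple of \<open>\<bar>t\<bar> * q ^ N\<close>. Going back to \<open>t\<close>
  amplifies this by a factor bounded in \<open>N\<close>.\<close>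

lemma integral_qHermite_shift:
  "integral {0..pi} (\<lambda>\<theta>. big_qHermite 0 q n (cos \<theta>) * shift_weight t \<theta>)
     = herm_mass * herm_shifted n t"
proof -
  \<comment> \<open>The amplification bound from \<open>qprod_le\<close> times the constant from
    \<open>herm_shifted_near_0\<close>.\<close>
  define C where "C = exp (2 * \<bar>t\<bar> / (1 - q)) * (\<bar>herm_mass\<bar> * phi 1)"
  have s: "(\<lambda>N. \<bar>t * q ^ N\<bar>) \<longlonglongrightarrow> 0"
    using abs_q by (intro tendsto_rabs_zero tendsto_mult_right_zero LIMSEQ_power_zero) auto
  have "\<forall>\<^sub>F N in sequentially. \<bar>t * q ^ N\<bar> < 1"
    using order_tendstoD(2)[OF s] by simp
  then have "\<forall>\<^sub>F N in sequentially. norm (fin_shifted N n t - herm_mass * herm_shifted n t) \<le> \<bar>t * q ^ N\<bar> * C"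
  proof eventually_elim
    case (elim N)
    let ?s = "t * q ^ N"
    have "\<bar>fin_shifted 0 n ?s - herm_mass * herm_shifted n ?s\<bar> \<le> \<bar>herm_mass\<bar> * (\<bar>?s\<bar> * phi 1)" for n
    proof -
      have "fin_shifted 0 n ?s - herm_mass * herm_shifted n ?s
          = - (herm_mass * (herm_shifted n ?s - (if n = 0 then 1 else 0)))"
        using integral_qHermite[of n] by (simp add: fin_shifted_def algebra_simps)
      then show ?thesis
        using herm_shifted_near_0[of ?s n] elim by (simp add: abs_mult mult_left_mono)
    qed
    then have "\<bar>fin_shifted N n t - herm_mass * herm_shifted n t\<bar>
        \<le> qprod q N (- \<bar>t\<bar>) 1 * (\<bar>herm_mass\<bar> * (\<bar>?s\<bar> * phi 1))"
      by (rule fin_shifted_error)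
    also have "\<dots> \<le> exp (2 * \<bar>- \<bar>t\<bar>\<bar> / (1 - q)) * (\<bar>herm_mass\<bar> * (\<bar>?s\<bar> * phi 1))"
      using q_pos q_less_1 phi_mono[of 0 1] phi_0
      by (intro mult_right_mono qprod_le) auto
    finally show ?case by (simp add: C_def mult_ac)
  qed
  moreover have "(\<lambda>N. \<bar>t * q ^ N\<bar> * C) \<longlonglongrightarrow> 0"
    using s by (rule tendsto_mult_left_zero)
  ultimately have "(\<lambda>N. fin_shifted N n t - herm_mass * herm_shifted n t) \<longlonglongrightarrow> 0"
    by (rule Lim_null_comparison)
  then have "(\<lambda>N. fin_shifted N n t) \<longlonglongrightarrow> herm_mass * herm_shifted n t"
    by (rule LIM_zero_cancel)
  with fin_shifted_LIMSEQ show ?thesis by (rule LIMSEQ_unique)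
qed

section \<open>Big \<open>q\<close>-Hermite polynomials\<close>

text \<open>Integer indices give the recurrence a meaning at \<open>n - 1\<close> and
  \<open>m - 1\<close> without truncation. At \<open>n = 0\<close> this is
  \<open>herm_shifted\<close>, at \<open>m = 0\<close> it is the first column of the final
  formula.\<close>

definition mixed_moment :: "real \<Rightarrow> int \<Rightarrow> int \<Rightarrow> real" where
  "mixed_moment a n m = (- a) powi n * (- (q / a)) powi m * tri_pow n * tri_pow m
     * q powi (- (n * m)) * phi (q powi (m - n) * (q / a)\<^sup>2)"

text \<open>Three arguments of \<open>phi\<close> occur, in ratio \<open>q\<close>;
  \<open>phi_q_difference\<close> eliminates the middle one, leaving \<open>P\<close> and
  \<open>R\<close>.\<close>

lemma mixed_moment_rec:
  assumes a: "a \<noteq> 0"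
  shows "mixed_moment a (n + 1) m + a * q powi n * mixed_moment a n m
      + (1 - q powi n) * mixed_moment a (n - 1) m
    = mixed_moment a n (m + 1) + (1 - q powi m) * mixed_moment a n (m - 1)"
proof -
  define X where "X = q powi n"
  define Y where "Y = q powi m"
  define t where "t = q / a"
  define G where "G = (- a) powi n * (- t) powi m * tri_pow n * tri_pow m * q powi (- (n * m))"
  define P where "P = phi (Y / (X * q) * t\<^sup>2)"
  define R where "R = phi (Y * q / X * t\<^sup>2)"
  have nz: "X \<noteq> 0" "Y \<noteq> 0" "t \<noteq> 0" using a by (auto simp: X_def Y_def t_def)
  have powi_diff1: "x powi (k - 1) = x powi k / x" if "x \<noteq> 0" for x :: real and k :: int
    using that by (simp add: power_int_diff)
  have e: "q powi (- ((n + 1) * m)) = q powi (- (n * m)) / Y"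
    "q powi (- ((n - 1) * m)) = q powi (- (n * m)) * Y"
    "q powi (- (n * (m + 1))) = q powi (- (n * m)) / X"
    "q powi (- (n * (m - 1))) = q powi (- (n * m)) * X"
    by (simp_all add: X_def Y_def power_int_diff power_int_add power_int_minus algebra_simps divide_inverse)
  have y: "q powi (m - (n + 1)) = Y / (X * q)" "q powi (m - (n - 1)) = Y * q / X"
    "q powi (m + 1 - n) = Y * q / X" "q powi (m - 1 - n) = Y / (X * q)" "q powi (m - n) = Y / X"
    by (simp_all add: X_def Y_def power_int_diff power_int_add)
  have f1: "mixed_moment a (n + 1) m = G * (- a * X / Y * P)"
    unfolding mixed_moment_def e y G_def P_def tri_pow_add1 t_def[symmetric]
    using a by (simp add: power_int_add X_def)
  have f2: "mixed_moment a n (m + 1) = G * (- t * Y / X * R)"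
    unfolding mixed_moment_def e y G_def R_def tri_pow_add1 t_def[symmetric]
    using nz by (simp add: power_int_add Y_def)
  have f3: "mixed_moment a (n - 1) m = G * (- (1 / a) * (q / X) * Y * R)"
    unfolding mixed_moment_def e y G_def R_def tri_pow_diff1 t_def[symmetric]
    using a by (simp add: powi_diff1 X_def)
  have f4: "mixed_moment a n (m - 1) = G * (- (1 / t) * (q / Y) * X * P)"
    unfolding mixed_moment_def e y G_def P_def tri_pow_diff1 t_def[symmetric]
    using nz by (simp add: powi_diff1 Y_def)
  have "P = phi (Y / X * t\<^sup>2) + Y / (X * q) * t\<^sup>2 * R"
  proof -
    have "q * (Y / (X * q) * t\<^sup>2) = Y / X * t\<^sup>2" "q\<^sup>2 * (Y / (X * q) * t\<^sup>2) = Y * q / X * t\<^sup>2"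
      using nz by (simp_all add: power2_eq_square)
    then show ?thesis
      using phi_q_difference[of "Y / (X * q) * t\<^sup>2"] unfolding P_def R_def by simp
  qed
  then have f0: "mixed_moment a n m = G * (P - Y / (X * q) * t\<^sup>2 * R)"
    unfolding mixed_moment_def y G_def t_def[symmetric] by simp
  \<comment> \<open>The coefficients of \<open>P\<close> and of \<open>R\<close> agree separately,
    by \<open>a * t = q\<close>.\<close>
  have "- a * X / Y * P + a * X * (P - Y / (X * q) * t\<^sup>2 * R) + (1 - X) * (- (1 / a) * (q / X) * Y * R)
     = - t * Y / X * R + (1 - Y) * (- (1 / t) * (q / Y) * X * P)"
    using nz a unfolding t_def by (simp add: field_simps power2_eq_square)
  then have "G * (- a * X / Y * P + a * X * (P - Y / (X * q) * t\<^sup>2 * R) + (1 - X) * (- (1 / a) * (q / X) * Y * R))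
     = G * (- t * Y / X * R + (1 - Y) * (- (1 / t) * (q / Y) * X * P))"
    by (rule arg_cong)
  then show ?thesis
    unfolding f0 f1 f2 f3 f4 X_def[symmetric] Y_def[symmetric]
    by (simp only: distrib_left mult.left_commute)
qed

text \<open>Passes from truncated to integer subtraction: at \<open>n = 0\<close> the coefficient
  vanishes.\<close>

lemma pred_coeff: "(1 - q ^ n) * f (int (n - 1)) = (1 - q ^ n) * f (int n - 1)"
  by (cases n) simp_all

text \<open>The pair recurrence raises \<open>n\<close> at the expense of a shift in
  \<open>m\<close>, so \<open>m\<close> stays arbitrary in the induction.\<close>

lemma integral_mixed:
  assumes a: "a \<noteq> 0"
  shows "integral {0..pi} (\<lambda>\<theta>. (big_qHermite a q n (cos \<theta>) * big_qHermite 0 q m (cos \<theta>)) * shift_weight (q / a) \<theta>)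
    = herm_mass * mixed_moment a (int n) (int m)"
proof (induction n arbitrary: m rule: less_induct)
  case (less n)
  show ?case
  proof (cases n)
    case 0
    then show ?thesis
      using integral_qHermite_shift[of m "q / a"] by (simp add: herm_shifted_def mixed_moment_def)
  next
    case (Suc k)
    let ?M = "\<lambda>n m. integral {0..pi} (\<lambda>\<theta>. (big_qHermite a q n (cos \<theta>) * big_qHermite 0 q m (cos \<theta>)) * shift_weight (q / a) \<theta>)"
    have IH: "?M k m = herm_mass * mixed_moment a (int k) (int m)"
      "?M (k - 1) m = herm_mass * mixed_moment a (int (k - 1)) (int m)" for m
      using less.IH Suc by auto
    have "?M (Suc k) m = ?M k (Suc m) + (1 - q ^ m) * ?M k (m - 1) - a * q ^ k * ?M k m - (1 - q ^ k) * ?M (k - 1) m"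
      using integral_big_qHermite_pair_rec[OF cos_weight_shift, of a q k 0 m "q / a"] by linarith
    also have "\<dots> = herm_mass * (mixed_moment a (int k) (int (Suc m))
        + (1 - q ^ m) * mixed_moment a (int k) (int (m - 1)) - a * q ^ k * mixed_moment a (int k) (int m)
        - (1 - q ^ k) * mixed_moment a (int (k - 1)) (int m))"
      unfolding IH by (simp only: algebra_simps)
    also have "\<dots> = herm_mass * mixed_moment a (int (Suc k)) (int m)"
      unfolding pred_coeff[of m "mixed_moment a (int k)"] pred_coeff[of k "\<lambda>j. mixed_moment a j (int m)"]
      using mixed_moment_rec[OF a, of "int k" "int m"] by (simp add: add.commute)
    finally show ?thesis by (simp only: Suc)
  qed
qed

definition big_moment :: "real \<Rightarrow> int \<Rightarrow> int \<Rightarrow> real" where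
  "big_moment a m n = (- a) powi (m + n) * tri_pow m * tri_pow n * phi (q powi (2 - m - n) / a\<^sup>2)"

text \<open>Once \<open>phi (q * y)\<close> is eliminated, \<open>phi y\<close> cancels on each
  side, and with \<open>p = phi (q\<^sup>2 * y)\<close> both sides equal
  \<open>G * (q / a - q / (a * X) - q / (a * Y)) * p\<close>, symmetric in \<open>X\<close> and
  \<open>Y\<close>.\<close>

lemma big_moment_rec:
  assumes a: "a \<noteq> 0"
  shows "big_moment a (m + 1) n + a * q powi m * big_moment a m n + (1 - q powi m) * big_moment a (m - 1) n
    = big_moment a m (n + 1) + a * q powi n * big_moment a m n + (1 - q powi n) * big_moment a m (n - 1)"
proof -
  define X where "X = q powi m"
  define Y where "Y = q powi n"
  define G where "G = (- a) powi (m + n) * tri_pow m * tri_pow n"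
  define y where "y = q powi (1 - m - n) / a\<^sup>2"
  have nz: "X \<noteq> 0" "Y \<noteq> 0" by (auto simp: X_def Y_def)
  have y: "y = q / (X * Y * a\<^sup>2)"
    by (simp add: y_def X_def Y_def power_int_diff)
  have ex: "m + 1 + n = m + n + 1" "m + (n + 1) = m + n + 1" "m - 1 + n = m + n - 1" "m + (n - 1) = m + n - 1"
     "2 - (m + 1) - n = 1 - m - n" "2 - m - (n + 1) = 1 - m - n"
     "2 - (m - 1) - n = 2 + (1 - m - n)" "2 - m - (n - 1) = 2 + (1 - m - n)"
    by simp_all
  have pw: "(- a) powi (m + n + 1) = (- a) powi (m + n) * (- a)" 
    "(- a) powi (m + n - 1) = - ((- a) powi (m + n) / a)"
    using a by (simp_all add: power_int_add power_int_diff)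
  have q2: "q powi (2 + (1 - m - n)) / a\<^sup>2 = q\<^sup>2 * y"
    unfolding y_def by (subst power_int_add) auto
  have "q powi (2 - m - n) / a\<^sup>2 = q * y"
    using power_int_add[of q 1 "1 - m - n"] by (simp add: y_def algebra_simps)
  then have f0: "big_moment a m n = G * (phi y - y * phi (q\<^sup>2 * y))"
    using phi_q_difference[of y] by (simp add: big_moment_def G_def)
  have f1: "big_moment a (m + 1) n = G * (- a * X * phi y)" "big_moment a m (n + 1) = G * (- a * Y * phi y)"
    unfolding big_moment_def ex pw tri_pow_add1 y_def[symmetric] G_def X_def Y_def by simp_all
  have f2: "big_moment a (m - 1) n = G * (- (q / (a * X)) * phi (q\<^sup>2 * y))"
     "big_moment a m (n - 1) = G * (- (q / (a * Y)) * phi (q\<^sup>2 * y))"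
    unfolding big_moment_def ex pw tri_pow_diff1 q2 G_def X_def Y_def by simp_all
  have "- a * X * phi y + a * X * (phi y - y * p) + (1 - X) * (- (q / (a * X)) * p)
     = - a * Y * phi y + a * Y * (phi y - y * p) + (1 - Y) * (- (q / (a * Y)) * p)" for p
  proof -
    have "a * X * y = q / (a * Y)" "a * Y * y = q / (a * X)"
      using nz a by (simp_all add: y power2_eq_square)
    moreover have "(1 - X) * (- (q / (a * X)) * p) = q / a * p - q / (a * X) * p"
      "(1 - Y) * (- (q / (a * Y)) * p) = q / a * p - q / (a * Y) * p"
      using nz a by (simp_all add: field_simps)
    moreover have "a * X * (phi y - y * p) = a * X * phi y - a * X * y * p"
      "a * Y * (phi y - y * p) = a * Y * phi y - a * Y * y * p"
      by (simp_all add: algebra_simps)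
    ultimately show ?thesis by simp
  qed
  then have "G * (- a * X * phi y + a * X * (phi y - y * p) + (1 - X) * (- (q / (a * X)) * p))
     = G * (- a * Y * phi y + a * Y * (phi y - y * p) + (1 - Y) * (- (q / (a * Y)) * p))" for p
    by (rule arg_cong)
  then show ?thesis
    unfolding f0 f1 f2 X_def[symmetric] Y_def[symmetric]
    by (simp only: distrib_left mult.left_commute)
qed

lemma integral_big_qHermite:
  assumes a: "a \<noteq> 0"
  shows "integral {0..pi} (\<lambda>\<theta>. (big_qHermite a q m (cos \<theta>) * big_qHermite a q n (cos \<theta>)) * shift_weight (q / a) \<theta>)
    = herm_mass * big_moment a (int m) (int n)"
proof (induction n arbitrary: m rule: less_induct)
  case (less n)
  show ?case
  proof (cases n)
    case 0
    \<comment> \<open>The polynomial of degree \<open>0\<close> is \<open>1\<close> for either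
      parameter, so this column is a mixed integral.\<close>
    have "q powi (- int m) * (q / a)\<^sup>2 = q powi (2 - int m) / a\<^sup>2"
      by (simp add: power_int_diff power_int_minus divide_inverse power_mult_distrib power_inverse)
    then show ?thesis
      using integral_mixed[OF a, of m 0] by (simp add: 0 mixed_moment_def big_moment_def)
  next
    case (Suc k)
    let ?M = "\<lambda>m n. integral {0..pi} (\<lambda>\<theta>. (big_qHermite a q m (cos \<theta>) * big_qHermite a q n (cos \<theta>)) * shift_weight (q / a) \<theta>)"
    have IH: "?M m k = herm_mass * big_moment a (int m) (int k)"
      "?M m (k - 1) = herm_mass * big_moment a (int m) (int (k - 1))" for m
      using less.IH Suc by auto
    have "?M m (Suc k) = ?M (Suc m) k + a * q ^ m * ?M m k + (1 - q ^ m) * ?M (m - 1) k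
        - a * q ^ k * ?M m k - (1 - q ^ k) * ?M m (k - 1)"
      using integral_big_qHermite_pair_rec[OF cos_weight_shift, of a q m a k "q / a"] by linarith
    also have "\<dots> = herm_mass * (big_moment a (int (Suc m)) (int k) + a * q ^ m * big_moment a (int m) (int k)
        + (1 - q ^ m) * big_moment a (int (m - 1)) (int k)
        - a * q ^ k * big_moment a (int m) (int k) - (1 - q ^ k) * big_moment a (int m) (int (k - 1)))"
      unfolding IH by (simp only: algebra_simps)
    also have "\<dots> = herm_mass * big_moment a (int m) (int (Suc k))"
      unfolding pred_coeff[of k "big_moment a (int m)"] pred_coeff[of m "\<lambda>j. big_moment a j (int k)"]
      using big_moment_rec[OF a, of "int m" "int k"] by (simp add: add.commute)
    finally show ?thesis by (simp only: Suc)
  qed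
qed

end

theorem mainTheorem6:
  fixes q a :: real and m n :: nat
  assumes "0 < q" and "q < 1" and "0 < \<bar>a\<bar>" and "\<bar>a\<bar> < 1"
  shows "qpoch_inf q q / (2 * pi) *
      integral {0..pi} (\<lambda>\<theta>.
        big_qHermite a q m (cos \<theta>) * big_qHermite a q n (cos \<theta>) *
        (cmod (qpoch_inf (exp (2 * \<i> * complex_of_real \<theta>)) (complex_of_real q) *
               qpoch_inf (complex_of_real q * exp (\<i> * complex_of_real \<theta>) / complex_of_real a)
                 (complex_of_real q)))\<^sup>2)
    = (- a) ^ (m + n) * q ^ ((m * (m - 1) + n * (n - 1)) div 2) *
      qphi01 0 q (q powi (2 - int m - int n) / a\<^sup>2)"
proof -
  interpret q_base q by unfold_locales fact+
  have a: "a \<noteq> 0" using assms by simp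
  \<comment> \<open>The stated weight is \<open>shift_weight\<close> at
    \<open>t = q / a\<close>.\<close>
  have "(cmod (qpoch_inf (exp (2 * \<i> * complex_of_real \<theta>)) (complex_of_real q) *
               qpoch_inf (complex_of_real q * exp (\<i> * complex_of_real \<theta>) / complex_of_real a)
                 (complex_of_real q)))\<^sup>2 = shift_weight (q / a) \<theta>" for \<theta>
  proof -
    have "exp (2 * \<i> * complex_of_real \<theta>) = cis (2 * \<theta>)"
      by (simp add: cis_conv_exp mult_ac)
    moreover have "complex_of_real q * exp (\<i> * complex_of_real \<theta>) / complex_of_real a
        = complex_of_real (q / a) * cis \<theta>"
      by (simp add: cis_conv_exp)
    ultimately show ?thesis
      by (simp only: shift_weight_def herm_weight_def norm_mult power_mult_distrib mult.commute)
  qed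
  moreover have "qpoch_inf q q / (2 * pi) * herm_mass = 1"
    using qpoch_inf_nz by (simp add: herm_mass_def)
  \<comment> \<open>The division splits because \<open>m * (m - 1)\<close> is even.\<close>
  moreover have "(m * (m - 1) + n * (n - 1)) div 2 = m * (m - 1) div 2 + n * (n - 1) div 2"
    by (rule div_plus_div_distrib_dvd_left) (cases "even m"; simp)
  then have "tri_pow (int m) * tri_pow (int n) = q ^ ((m * (m - 1) + n * (n - 1)) div 2)"
    by (simp only: tri_pow_def tri_int power_int_of_nat power_add)
  moreover have "(- a) powi (int m + int n) = (- a) ^ (m + n)"
    by (simp only: of_nat_add[symmetric] power_int_of_nat)
  ultimately show ?thesis
    by (simp only: integral_big_qHermite[OF a] big_moment_def phi_def mult.assoc[symmetric]) 
      (simp only: mult.assoc mult_1)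
qed

end
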